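(* Let $V:\mathbb{R}\to\mathbb{R}$ and $W:\mathbb{R}\to\mathbb{R}$ be functions with $W(x)=W(-x)$ for all $x$, and let $[a,b]$ be partitioned into $N$ (possibly nonuniform) cells as in the context. Let $\rho(t)=(\rho_1(t),\dots,\rho_N(t))$, $t\ge 0$, be a solution of the semi-discrete scheme $$\frac{d}{dt}\rho_j=\frac{C_{j+1/2}-C_{j-1/2}}{h_j},\qquad j=1,\dots,N,$$ with the fluxes $C_{j+1/2}$ defined in the context. Then the scheme satisfies the following properties: (1) Conservation of mass: for any $t>0$, $$\sum_{j=1}^N h_j\rho_j(t)=\sum_{j=1}^N h_j\rho_j(0).$$ (2) Positivity preserving: if $\rho_j(0)\ge 0$ for all $j\in\{1,\dots,N\}$, then $\rho_j(t)\ge 0$ for all $j$ and any $t>0$. (3) Entropy dissipation: $\dfrac{dE_h(t)}{dt}\le -I_h$, where $$E_h(t)=\sum_{j=1}^N h_j\Big(\rho_j\log(\rho_j)+V_j\rho_j+\tfrac12 g_j\rho_j\Big),\qquad V_j=V(x_j),\qquad g_j=\sum_{i=1}^N h_iW(x_i-x_j)\rho_i,$$ and $$I_h=\sum_{j=1}^{N-1}C_{j+1/2}\left(\log\Big(\frac{\rho_{j+1}}{M_{j+1}}\Big)-\log\Big(\frac{\rho_j}{M_j}\Big)\right)\ge 0.$$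
   Context: Mesh: $\Omega=[a,b]$ is partitioned into cells $I_j=[x_{j-1/2},x_{j+1/2}]$, $j=1,\dots,N$, with $x_{1/2}=a$, $x_{N+1/2}=b$, sizes $h_j=|I_j|>0$, and centers $x_j=x_{j-1/2}+\frac12 h_j$. Set $h_{j+1/2}=(h_j+h_{j+1})/2$. For $x\in\mathbb{R}$ and $v\in\mathbb{R}^N$ define $$Q_1(x,v)=\exp\Big(-V(x)-\sum_{i=1}^N h_iW(x_i-x)v_i\Big).$$ In the semi-discrete scheme, $M_{j+1/2}=Q_1(x_{j+1/2},\rho)$, $M_j=Q_1(x_j,\rho)$ (evaluated at the current $\rho=\rho(t)$), and $$C_{j+1/2}=\frac{M_{j+1/2}}{h_{j+1/2}}\left(\frac{\rho_{j+1}}{M_{j+1}}-\frac{\rho_j}{M_j}\right)\ \ (j=1,\dots,N-1),\qquad C_{1/2}=C_{N+1/2}=0.$$ The unknown $\rho_j(t)$ approximates the average over $I_j$ of the solution of $\partial_t\rho=\partial_x(\partial_x\rho+\rho\,\partial_x(V+W*\rho))$ on $[a,b]$ with zero flux boundary conditions. The quantity $E_h$ is a semi-discrete version of the free energy $\int_\Omega\rho\log\rho\,dx+\int_\Omega V\rho\,dx+\frac12\int_\Omega\int_\Omega W(x-y)\rho(y)\rho(x)\,dy\,dx$. *)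

theory Defs
  imports Complex_Main
begin

text \<open>
  A mesh of \<open>[a,b]\<close> with \<open>N\<close> cells is given by its edges \<open>e :: nat \<Rightarrow> real\<close>, where \<open>e j\<close>
  stands for \<open>x_{j+1/2}\<close>, \<open>j = 0, \<dots>, N\<close>; the cells are \<open>[e (j - 1), e j]\<close> for \<open>j = 1, \<dots>, N\<close>.
  Vectors in \<open>R^N\<close> are functions on \<open>nat\<close>, of which only the values at \<open>1, \<dots>, N\<close> matter.
  Throughout, a half-integer index \<open>j+1/2\<close> is encoded by \<open>j\<close>.
\<close>

definition is_mesh :: "real \<Rightarrow> real \<Rightarrow> nat \<Rightarrow> (nat \<Rightarrow> real) \<Rightarrow> bool" where
  "is_mesh a b N e \<longleftrightarrow> 1 \<le> N \<and> e 0 = a \<and> e N = b \<and> (\<forall>j\<in>{1..N}. e (j - 1) < e j)"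

definition cell_size :: "(nat \<Rightarrow> real) \<Rightarrow> nat \<Rightarrow> real" where
  "cell_size e j = e j - e (j - 1)"

definition cell_center :: "(nat \<Rightarrow> real) \<Rightarrow> nat \<Rightarrow> real" where
  "cell_center e j = e (j - 1) + cell_size e j / 2"

definition half_size :: "(nat \<Rightarrow> real) \<Rightarrow> nat \<Rightarrow> real" where
  "half_size e j = (cell_size e j + cell_size e (j + 1)) / 2"

definition Q1 :: "nat \<Rightarrow> (nat \<Rightarrow> real) \<Rightarrow> (real \<Rightarrow> real) \<Rightarrow> (real \<Rightarrow> real) \<Rightarrow>
    real \<Rightarrow> (nat \<Rightarrow> real) \<Rightarrow> real" where
  "Q1 N e V W x v = exp (- V x - (\<Sum>i=1..N. cell_size e i * W (cell_center e i - x) * v i))"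

definition M_center :: "nat \<Rightarrow> (nat \<Rightarrow> real) \<Rightarrow> (real \<Rightarrow> real) \<Rightarrow> (real \<Rightarrow> real) \<Rightarrow>
    (nat \<Rightarrow> real) \<Rightarrow> nat \<Rightarrow> real" where
  "M_center N e V W v j = Q1 N e V W (cell_center e j) v"

definition M_half :: "nat \<Rightarrow> (nat \<Rightarrow> real) \<Rightarrow> (real \<Rightarrow> real) \<Rightarrow> (real \<Rightarrow> real) \<Rightarrow>
    (nat \<Rightarrow> real) \<Rightarrow> nat \<Rightarrow> real" where
  "M_half N e V W v j = Q1 N e V W (e j) v"

definition flux :: "nat \<Rightarrow> (nat \<Rightarrow> real) \<Rightarrow> (real \<Rightarrow> real) \<Rightarrow> (real \<Rightarrow> real) \<Rightarrow>
    (nat \<Rightarrow> real) \<Rightarrow> nat \<Rightarrow> real" where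
  "flux N e V W v j =
    (if 1 \<le> j \<and> j < N
     then M_half N e V W v j / half_size e j *
       (v (j + 1) / M_center N e V W v (j + 1) - v j / M_center N e V W v j)
     else 0)"

text \<open>The derivative at \<open>t = 0\<close> is one-sided; the values of \<open>\<rho>\<close> at negative times are irrelevant.\<close>

definition scheme_solution :: "nat \<Rightarrow> (nat \<Rightarrow> real) \<Rightarrow> (real \<Rightarrow> real) \<Rightarrow> (real \<Rightarrow> real) \<Rightarrow>
    (real \<Rightarrow> nat \<Rightarrow> real) \<Rightarrow> bool" where
  "scheme_solution N e V W \<rho> \<longleftrightarrow>
    (\<forall>t\<ge>0. \<forall>j\<in>{1..N}.
      ((\<lambda>s. \<rho> s j) has_real_derivative
        (flux N e V W (\<rho> t) j - flux N e V W (\<rho> t) (j - 1)) / cell_size e j) (at t within {0..}))"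

definition g_conv :: "nat \<Rightarrow> (nat \<Rightarrow> real) \<Rightarrow> (real \<Rightarrow> real) \<Rightarrow> (nat \<Rightarrow> real) \<Rightarrow> nat \<Rightarrow> real" where
  "g_conv N e W v j =
    (\<Sum>i=1..N. cell_size e i * W (cell_center e i - cell_center e j) * v i)"

text \<open>The term \<open>v j * ln (v j)\<close> follows the usual convention \<open>0 log 0 = 0\<close>.\<close>

definition free_energy :: "nat \<Rightarrow> (nat \<Rightarrow> real) \<Rightarrow> (real \<Rightarrow> real) \<Rightarrow> (real \<Rightarrow> real) \<Rightarrow>
    (nat \<Rightarrow> real) \<Rightarrow> real" where
  "free_energy N e V W v =
    (\<Sum>j=1..N. cell_size e j *
      (v j * ln (v j) + V (cell_center e j) * v j + 1/2 * g_conv N e W v j * v j))"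

text \<open>
  This is the intended quantity only if all \<open>v j\<close> are positive, or if \<open>v\<close> vanishes on all cells,
  where all fluxes, and hence the sum, are zero. In HOL \<open>ln 0 = 0\<close>, so when some but not all of
  the \<open>v j\<close> are zero the value is meaningless.
\<close>

definition dissipation :: "nat \<Rightarrow> (nat \<Rightarrow> real) \<Rightarrow> (real \<Rightarrow> real) \<Rightarrow> (real \<Rightarrow> real) \<Rightarrow>
    (nat \<Rightarrow> real) \<Rightarrow> real" where
  "dissipation N e V W v =
    (\<Sum>j=1..N-1. flux N e V W v j *
      (ln (v (j + 1) / M_center N e V W v (j + 1)) - ln (v j / M_center N e V W v j)))"

text \<open>At \<open>t = 0\<close> the derivative of the energy is one-sided.\<close>

definition entropy_dissipation_at :: "nat \<Rightarrow> (nat \<Rightarrow> real) \<Rightarrow> (real \<Rightarrow> real) \<Rightarrow> (real \<Rightarrow> real) \<Rightarrow>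
    (real \<Rightarrow> nat \<Rightarrow> real) \<Rightarrow> real \<Rightarrow> bool" where
  "entropy_dissipation_at N e V W \<rho> t \<longleftrightarrow>
    (\<exists>D. ((\<lambda>s. free_energy N e V W (\<rho> s)) has_real_derivative D) (at t within {0..}) \<and>
         D \<le> - dissipation N e V W (\<rho> t)) \<and>
    0 \<le> dissipation N e V W (\<rho> t)"

end

theory Submission
  imports Defs "HOL-Analysis.Analysis"
begin

text \<open>
  With \<open>p\<^sub>j = \<rho>\<^sub>j / M\<^sub>j\<close> the flux through an interior edge is \<open>c\<^sub>j (p\<^sub>j\<^sub>+\<^sub>1 - p\<^sub>j)\<close> with a positive
  coefficient \<open>c\<^sub>j\<close>, so along a given solution the scheme is a linear diffusion on the path
  \<open>1, \<dots>, N\<close> whose coefficients depend continuously on time. All the properties follow from this.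

  Mass is conserved because the fluxes telescope and vanish at both ends.

  Nonnegativity is a minimum principle: a neighbour enters the equation for \<open>\<rho>\<^sub>j\<close> with a
  nonnegative coefficient, so a negative minimal entry decreases at most exponentially
  (\<open>flux_difference_lower_bound\<close>), and a comparison with \<open>- \<epsilon> exp ((L + 1) t)\<close> shows that no entry
  can become negative at all (\<open>minimum_principle\<close>).

  The derivative of the free energy is \<open>\<Sum>\<^sub>j h\<^sub>j (log p\<^sub>j + 1) \<rho>\<^sub>j'\<close>, since \<open>log M\<^sub>j = - V\<^sub>j - g\<^sub>j\<close> and \<open>W\<close>
  is even. Summation by parts turns it into \<open>- I\<^sub>h\<close>, and \<open>I\<^sub>h \<ge> 0\<close> because the logarithm is
  increasing. This needs positive densities. For nonnegative initial data a strong minimum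
  principle provides them at every positive time, unless the solution is identically zero
  (\<open>positive_or_identically_zero\<close>): a zero of \<open>\<rho>\<^sub>j\<close> at \<open>t > 0\<close> is an interior
  minimum in time, so \<open>\<rho>\<^sub>j'\<close> vanishes there, which forces both neighbours to vanish as well.
  Hence all densities vanish at time \<open>t\<close>, the conserved mass is zero, and the solution is
  identically zero; its energy is constant and there is nothing to dissipate.
\<close>

section \<open>Mesh and fluxes\<close>

definition conductance :: "nat \<Rightarrow> (nat \<Rightarrow> real) \<Rightarrow> (real \<Rightarrow> real) \<Rightarrow> (real \<Rightarrow> real) \<Rightarrow>
    (nat \<Rightarrow> real) \<Rightarrow> nat \<Rightarrow> real" where
  "conductance N e V W v j =
    (if 1 \<le> j \<and> j < N then M_half N e V W v j / half_size e j else 0)"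

lemma M_center_pos: "0 < M_center N e V W v j"
  by (simp add: M_center_def Q1_def)

lemma cell_size_pos:
  assumes "is_mesh a b N e" "j \<in> {1..N}"
  shows "0 < cell_size e j"
  using assms by (auto simp: is_mesh_def cell_size_def)

lemma half_size_pos:
  assumes "is_mesh a b N e" "1 \<le> j" "j < N"
  shows "0 < half_size e j"
  using cell_size_pos[OF assms(1), of j] cell_size_pos[OF assms(1), of "j + 1"] assms(2,3)
  by (auto simp: half_size_def)

lemma conductance_pos:
  assumes "is_mesh a b N e" "1 \<le> j" "j < N"
  shows "0 < conductance N e V W v j"
  using half_size_pos[OF assms] assms(2,3) by (simp add: conductance_def M_half_def Q1_def)

lemma conductance_nonneg:
  assumes "is_mesh a b N e"
  shows "0 \<le> conductance N e V W v j"
  using conductance_pos[OF assms, of j V W v] by (cases "1 \<le> j \<and> j < N") (auto simp: conductance_def)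

lemma flux_eq_conductance:
  "flux N e V W v j = conductance N e V W v j *
    (v (j + 1) / M_center N e V W v (j + 1) - v j / M_center N e V W v j)"
  by (simp add: flux_def conductance_def)

lemma flux_boundary: "flux N e V W v 0 = 0" "flux N e V W v N = 0"
  by (auto simp: flux_def)

text \<open>
  This holds also in the first and in the last cell, because the conductance of a boundary edge
  is zero and removes the values outside the mesh.
\<close>

lemma flux_difference:
  assumes "1 \<le> j"
  shows "flux N e V W v j - flux N e V W v (j - 1) =
    conductance N e V W v j / M_center N e V W v (j + 1) * v (j + 1)
    + conductance N e V W v (j - 1) / M_center N e V W v (j - 1) * v (j - 1)
    - (conductance N e V W v j + conductance N e V W v (j - 1)) / M_center N e V W v j * v j"
  using assms by (simp add: flux_eq_conductance algebra_simps add_divide_distrib)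

text \<open>
  The rate of inflow into cell \<open>j\<close> if both neighbours had density \<open>1\<close>; it controls how fast a
  negative minimal density can decrease.
\<close>

definition inflow_rate :: "nat \<Rightarrow> (nat \<Rightarrow> real) \<Rightarrow> (real \<Rightarrow> real) \<Rightarrow> (real \<Rightarrow> real) \<Rightarrow>
    (nat \<Rightarrow> real) \<Rightarrow> nat \<Rightarrow> real" where
  "inflow_rate N e V W v j =
    (conductance N e V W v j / M_center N e V W v (j + 1)
     + conductance N e V W v (j - 1) / M_center N e V W v (j - 1)) / cell_size e j"

lemma inflow_rate_nonneg:
  assumes "is_mesh a b N e" "j \<in> {1..N}"
  shows "0 \<le> inflow_rate N e V W v j"
  using conductance_nonneg[OF assms(1)] M_center_pos cell_size_pos[OF assms]
  by (auto simp: inflow_rate_def intro!: divide_nonneg_pos add_nonneg_nonneg)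

text \<open>
  At a negative minimum the outflow term of \<open>flux_difference\<close> has a favourable sign, and the
  inflow from a neighbour is at least what it would be if the neighbour had the minimal value.
\<close>

lemma flux_difference_lower_bound:
  assumes mesh: "is_mesh a b N e" and j: "j \<in> {1..N}"
    and neg: "v j < 0" and minimal: "\<And>i. i \<in> {1..N} \<Longrightarrow> v j \<le> v i"
  shows "inflow_rate N e V W v j * v j
    \<le> (flux N e V W v j - flux N e V W v (j - 1)) / cell_size e j"
proof -
  let ?c = "conductance N e V W v" and ?M = "M_center N e V W v"
  have weight: "0 \<le> ?c i / ?M k" for i k
    using conductance_nonneg[OF mesh] M_center_pos by (simp add: less_imp_le)
  have right: "?c j / ?M (j + 1) * v j \<le> ?c j / ?M (j + 1) * v (j + 1)"
  proof (cases "j < N")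
    case True
    then show ?thesis using minimal[of "j + 1"] weight by (intro mult_left_mono) auto
  qed (simp add: conductance_def)
  have left: "?c (j - 1) / ?M (j - 1) * v j \<le> ?c (j - 1) / ?M (j - 1) * v (j - 1)"
  proof (cases "1 \<le> j - 1")
    case True
    then show ?thesis using minimal[of "j - 1"] weight j by (intro mult_left_mono) auto
  qed (simp add: conductance_def)
  have out: "(?c j + ?c (j - 1)) / ?M j * v j \<le> 0"
    using neg weight[of j j] weight[of "j - 1" j]
    by (intro mult_nonneg_nonpos) (auto simp: add_divide_distrib)
  have "(?c j / ?M (j + 1) + ?c (j - 1) / ?M (j - 1)) * v j
      \<le> flux N e V W v j - flux N e V W v (j - 1)"
    using right left out flux_difference[of j N e V W v] j
    by (simp only: distrib_right atLeastAtMost_iff)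
  then show ?thesis
    using cell_size_pos[OF mesh j] by (simp add: inflow_rate_def divide_right_mono)
qed

text \<open>
  With \<open>v j = 0\<close> there is no outflow, and the inflow is a sum of two nonnegative terms; it can
  vanish only if both terms do.
\<close>

lemma neighbours_vanish:
  assumes mesh: "is_mesh a b N e" and j: "j \<in> {1..N}"
    and nonneg: "\<And>i. i \<in> {1..N} \<Longrightarrow> 0 \<le> v i"
    and zero: "v j = 0" and stationary: "flux N e V W v j = flux N e V W v (j - 1)"
  shows "j < N \<Longrightarrow> v (j + 1) = 0" and "1 < j \<Longrightarrow> v (j - 1) = 0"
proof -
  let ?c = "conductance N e V W v" and ?M = "M_center N e V W v"
  have weight: "0 \<le> ?c i / ?M k" for i k
    using conductance_nonneg[OF mesh] M_center_pos by (simp add: less_imp_le)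
  have right: "0 \<le> ?c j / ?M (j + 1) * v (j + 1)"
  proof (cases "j < N")
    case True
    then show ?thesis using nonneg weight by (intro mult_nonneg_nonneg) auto
  qed (simp add: conductance_def)
  have left: "0 \<le> ?c (j - 1) / ?M (j - 1) * v (j - 1)"
  proof (cases "1 \<le> j - 1")
    case True
    then show ?thesis using nonneg weight j by (intro mult_nonneg_nonneg) auto
  qed (simp add: conductance_def)
  have "?c j / ?M (j + 1) * v (j + 1) + ?c (j - 1) / ?M (j - 1) * v (j - 1) = 0"
    using flux_difference[of j N e V W v] j zero stationary by simp
  with left right have *: "?c j / ?M (j + 1) * v (j + 1) = 0" "?c (j - 1) / ?M (j - 1) * v (j - 1) = 0"
    by linarith+
  show "v (j + 1) = 0" if "j < N"
    using *(1) conductance_pos[OF mesh, of j V W v] M_center_pos[of N e V W v "j + 1"] that j by auto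
  show "v (j - 1) = 0" if "1 < j"
  proof -
    have "0 < ?c (j - 1)" using that j by (intro conductance_pos[OF mesh]) auto
    then show ?thesis using *(2) M_center_pos[of N e V W v "j - 1"] by auto
  qed
qed

text \<open>
  The two boundary terms are kept so that the formula can be proved by induction on the number of
  cells; for the fluxes of the scheme they vanish.
\<close>

lemma summation_by_parts:
  fixes \<phi> F :: "nat \<Rightarrow> real"
  shows "(\<Sum>j=1..Suc n. \<phi> j * (F j - F (j - 1)))
    = \<phi> (Suc n) * F (Suc n) - \<phi> 1 * F 0 - (\<Sum>j=1..n. F j * (\<phi> (j + 1) - \<phi> j))"
  by (induction n) (simp_all add: algebra_simps)

lemma summation_by_parts_flux:
  assumes "is_mesh a b N e"
  shows "(\<Sum>j=1..N. \<phi> j * (flux N e V W v j - flux N e V W v (j - 1)))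
    = - (\<Sum>j=1..N-1. flux N e V W v j * (\<phi> (j + 1) - \<phi> j))"
proof -
  obtain n where "N = Suc n"
    using assms by (cases N) (auto simp: is_mesh_def)
  then show ?thesis
    using summation_by_parts[of \<phi> "flux N e V W v" n] flux_boundary[of N e V W v] by simp
qed

section \<open>A minimum principle for systems of differential equations\<close>

text \<open>
  Suppose that some component touches the curve \<open>- \<epsilon> exp ((L + 1) t)\<close> for the first time. It is
  then minimal and negative, so its derivative is at least \<open>L\<close> times its value, which is strictly
  more than the slope of the curve, \<open>L + 1\<close> times that value. Hence it was below the curve just
  before, a contradiction. Letting \<open>\<epsilon>\<close> tend to zero gives nonnegativity.
\<close>

lemma minimum_principle:
  fixes u d :: "real \<Rightarrow> 'a \<Rightarrow> real"
  assumes fin: "finite J"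
    and deriv: "\<And>t j. t \<in> {0..T} \<Longrightarrow> j \<in> J \<Longrightarrow>
      ((\<lambda>s. u s j) has_real_derivative d t j) (at t within {0..T})"
    and init: "\<And>j. j \<in> J \<Longrightarrow> 0 \<le> u 0 j"
    and low: "\<And>t j. t \<in> {0..T} \<Longrightarrow> j \<in> J \<Longrightarrow> u t j < 0 \<Longrightarrow> (\<And>i. i \<in> J \<Longrightarrow> u t j \<le> u t i) \<Longrightarrow>
      L * u t j \<le> d t j"
    and t: "t \<in> {0..T}" and j: "j \<in> J"
  shows "0 \<le> u t j"
proof -
  have barrier: "0 < u t j + \<epsilon> * exp ((L + 1) * t)"
    if \<epsilon>: "0 < \<epsilon>" and t: "t \<in> {0..T}" and j: "j \<in> J" for \<epsilon> t j
  proof (rule ccontr)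
    define w where "w i s = u s i + \<epsilon> * exp ((L + 1) * s)" for i s
    assume "\<not> 0 < u t j + \<epsilon> * exp ((L + 1) * t)"
    then have below: "w j t \<le> 0" by (simp add: w_def)
    have cont: "continuous_on {0..T} (w i)" if "i \<in> J" for i
      unfolding w_def
      by (intro continuous_intros DERIV_continuous_on[OF deriv[OF _ that]])
    define S where "S = (\<Union>i\<in>J. {0..T} \<inter> w i -` {..0})"
    have "compact ({0..T} \<inter> w i -` {..0})" if "i \<in> J" for i
      using continuous_closed_preimage[OF cont[OF that], of "{..0}"]
      by (simp add: compact_eq_bounded_closed bounded_Int)
    then have "compact S"
      unfolding S_def by (intro compact_UN fin)
    moreover have "t \<in> S"
      using below t j by (auto simp: S_def)
    ultimately obtain s where s: "s \<in> S" and first: "\<And>r. r \<in> S \<Longrightarrow> s \<le> r"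
      using compact_attains_inf[of S] by blast
    then obtain k where k: "k \<in> J" "s \<in> {0..T}" "w k s \<le> 0"
      by (auto simp: S_def)
    have start: "0 < w i 0" if "i \<in> J" for i
      using init[OF that] \<epsilon> by (simp add: w_def add_nonneg_pos)
    have "s \<noteq> 0" using k start[of k] by auto
    then have "0 < s" using k by auto
    have above: "0 \<le> w i s" if i: "i \<in> J" for i
    proof (rule ccontr)
      assume neg: "\<not> 0 \<le> w i s"
      have "continuous_on {0..s} (w i)"
        using continuous_on_subset[OF cont[OF i]] k by auto
      then obtain r where r: "0 \<le> r" "r \<le> s" "w i r = 0"
        using IVT2'[of "w i" s 0 0] neg start[OF i] \<open>0 < s\<close> by auto
      then have "r \<in> S" using i k unfolding S_def by (intro UN_I[of i]) auto
      then have "r = s" using first r by force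
      then show False using r neg by simp
    qed
    have touch: "w k s = 0" using above[OF k(1)] k by simp
    then have u_eq: "u s k = - (\<epsilon> * exp ((L + 1) * s))" by (simp add: w_def)
    have "u s k \<le> u s i" if "i \<in> J" for i
      using above[OF that] u_eq by (simp add: w_def)
    moreover have "u s k < 0"
      using u_eq \<epsilon> by simp
    ultimately have "L * u s k \<le> d s k"
      using k by (intro low) auto
    moreover have "(L + 1) * (\<epsilon> * exp ((L + 1) * s)) = - (L * u s k) + \<epsilon> * exp ((L + 1) * s)"
      by (simp add: u_eq algebra_simps)
    ultimately have pos: "0 < d s k + (L + 1) * (\<epsilon> * exp ((L + 1) * s))"
      using \<epsilon> by (smt (verit) exp_gt_zero mult_pos_pos)
    have "(w k has_real_derivative d s k + (L + 1) * (\<epsilon> * exp ((L + 1) * s))) (at s within {0..T})"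
      unfolding w_def
      by (rule derivative_eq_intros deriv k refl)+ simp
    from has_real_derivative_pos_inc_left[OF this pos]
    obtain \<delta> where \<delta>: "0 < \<delta>" and
      inc: "\<And>h. 0 < h \<Longrightarrow> s - h \<in> {0..T} \<Longrightarrow> h < \<delta> \<Longrightarrow> w k (s - h) < w k s"
      by blast
    \<comment> \<open>A time before \<open>s\<close>, still in the interval, at which \<open>w k\<close> is already negative.\<close>
    define h where "h = min (\<delta> / 2) s"
    have h: "0 < h" "h < \<delta>" "s - h \<in> {0..T}"
      using \<delta> \<open>0 < s\<close> k by (auto simp: h_def)
    with inc touch have "w k (s - h) < 0" by metis
    then have "s - h \<in> S" using k h unfolding S_def by (intro UN_I[of k]) auto
    then show False using first[of "s - h"] h by auto
  qed
  show ?thesis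
  proof (rule field_le_epsilon)
    fix \<epsilon> :: real
    assume "0 < \<epsilon>"
    then have "0 < u t j + \<epsilon> / exp ((L + 1) * t) * exp ((L + 1) * t)"
      by (intro barrier t j) simp
    then show "0 \<le> u t j + \<epsilon>" by simp
  qed
qed

section \<open>Mass and sign of the solution\<close>

lemma scheme_solution_deriv:
  assumes "scheme_solution N e V W \<rho>" "0 \<le> t" "j \<in> {1..N}"
  shows "((\<lambda>s. \<rho> s j) has_real_derivative
    (flux N e V W (\<rho> t) j - flux N e V W (\<rho> t) (j - 1)) / cell_size e j) (at t within {0..})"
  using assms by (auto simp: scheme_solution_def)

lemma mass_conservation:
  assumes mesh: "is_mesh a b N e" and sol: "scheme_solution N e V W \<rho>" and t: "0 \<le> t"
  shows "(\<Sum>j=1..N. cell_size e j * \<rho> t j) = (\<Sum>j=1..N. cell_size e j * \<rho> 0 j)"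
proof -
  have "((\<lambda>s. \<Sum>j=1..N. cell_size e j * \<rho> s j) has_real_derivative 0) (at s within {0..})"
    if s: "s \<in> {0..}" for s
  proof -
    have "((\<lambda>s. \<Sum>j=1..N. cell_size e j * \<rho> s j) has_real_derivative
        (\<Sum>j=1..N. cell_size e j *
          ((flux N e V W (\<rho> s) j - flux N e V W (\<rho> s) (j - 1)) / cell_size e j))) (at s within {0..})"
      using s by (intro DERIV_sum DERIV_cmult scheme_solution_deriv[OF sol]) auto
    also have "(\<Sum>j=1..N. cell_size e j *
          ((flux N e V W (\<rho> s) j - flux N e V W (\<rho> s) (j - 1)) / cell_size e j))
        = (\<Sum>j=1..N. 1 * (flux N e V W (\<rho> s) j - flux N e V W (\<rho> s) (j - 1)))"
      using cell_size_pos[OF mesh] by (intro sum.cong refl) force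
    also have "\<dots> = 0"
      using summation_by_parts_flux[OF mesh, of "\<lambda>_. 1"] by simp
    finally show ?thesis .
  qed
  from has_field_derivative_zero_constant[OF _ this] t show ?thesis
    by fastforce
qed

lemma inflow_rate_continuous_on:
  assumes sol: "scheme_solution N e V W \<rho>" and mesh: "is_mesh a b N e" and j: "j \<in> {1..N}"
  shows "continuous_on {0..} (\<lambda>t. inflow_rate N e V W (\<rho> t) j)"
proof -
  have "continuous_on {0..} (\<lambda>t. \<rho> t i)" if "i \<in> {1..N}" for i
    using scheme_solution_deriv[OF sol _ that] by (intro DERIV_continuous_on) auto
  then have Q: "continuous_on {0..} (\<lambda>t. Q1 N e V W x (\<rho> t))" for x
    unfolding Q1_def by (intro continuous_intros) auto
  have c: "continuous_on {0..} (\<lambda>t. conductance N e V W (\<rho> t) i)" for i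
    unfolding conductance_def M_half_def using half_size_pos[OF mesh, of i]
    by (cases "1 \<le> i \<and> i < N") (auto intro!: continuous_on_divide Q)
  show ?thesis
    unfolding inflow_rate_def M_center_def
    by (intro continuous_intros c Q) (use cell_size_pos[OF mesh j] in \<open>auto simp: Q1_def\<close>)
qed

lemma positivity_preserving:
  assumes mesh: "is_mesh a b N e" and sol: "scheme_solution N e V W \<rho>"
    and init: "\<And>j. j \<in> {1..N} \<Longrightarrow> 0 \<le> \<rho> 0 j"
    and t: "0 \<le> t" and j: "j \<in> {1..N}"
  shows "0 \<le> \<rho> t j"
proof -
  \<comment> \<open>The sum over the cells serves as a bound that is uniform in the cell index.\<close>
  let ?K = "\<lambda>s. \<Sum>i=1..N. inflow_rate N e V W (\<rho> s) i"
  have "continuous_on {0..t} ?K"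
    by (intro continuous_intros continuous_on_subset[OF inflow_rate_continuous_on[OF sol mesh]]) auto
  then obtain L where L: "\<And>s. s \<in> {0..t} \<Longrightarrow> ?K s \<le> L"
    using continuous_attains_sup[of "{0..t}" ?K] t by fastforce
  show ?thesis
  proof (rule minimum_principle[where J = "{1..N}" and T = t and u = \<rho> and L = L])
    fix s i assume s: "s \<in> {0..t}" and i: "i \<in> {1..N}"
    show "((\<lambda>s. \<rho> s i) has_real_derivative
        (flux N e V W (\<rho> s) i - flux N e V W (\<rho> s) (i - 1)) / cell_size e i) (at s within {0..t})"
      using s by (intro has_field_derivative_subset[OF scheme_solution_deriv[OF sol _ i]]) auto
    assume neg: "\<rho> s i < 0" and minimal: "\<And>k. k \<in> {1..N} \<Longrightarrow> \<rho> s i \<le> \<rho> s k"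
    have "inflow_rate N e V W (\<rho> s) i \<le> ?K s"
      using i inflow_rate_nonneg[OF mesh] by (intro member_le_sum) auto
    also have "\<dots> \<le> L" by (rule L[OF s])
    finally have "L * \<rho> s i \<le> inflow_rate N e V W (\<rho> s) i * \<rho> s i"
      using neg by (intro mult_right_mono_neg) auto
    also have "\<dots> \<le> (flux N e V W (\<rho> s) i - flux N e V W (\<rho> s) (i - 1)) / cell_size e i"
      by (rule flux_difference_lower_bound[of _ _ _ _ _ "\<rho> s", OF mesh i neg minimal])
    finally show "L * \<rho> s i
        \<le> (flux N e V W (\<rho> s) i - flux N e V W (\<rho> s) (i - 1)) / cell_size e i" .
  qed (use init t j in auto)
qed

text \<open>
  A zero at a positive time is an interior minimum in time, so the time derivative, a
  nonnegative combination of the two neighbouring densities, vanishes there. Zeros therefore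
  spread from cell to cell.
\<close>

lemma one_zero_imp_all_zero:
  assumes mesh: "is_mesh a b N e" and sol: "scheme_solution N e V W \<rho>"
    and init: "\<And>j. j \<in> {1..N} \<Longrightarrow> 0 \<le> \<rho> 0 j"
    and t: "0 < t" and j: "j \<in> {1..N}" and zero: "\<rho> t j = 0" and i: "i \<in> {1..N}"
  shows "\<rho> t i = 0"
proof -
  have nonneg: "0 \<le> \<rho> s k" if "0 \<le> s" "k \<in> {1..N}" for s k
    by (rule positivity_preserving[OF mesh sol init that])
  have stationary: "flux N e V W (\<rho> t) k = flux N e V W (\<rho> t) (k - 1)"
    if k: "k \<in> {1..N}" and zk: "\<rho> t k = 0" for k
  proof -
    let ?D = "(flux N e V W (\<rho> t) k - flux N e V W (\<rho> t) (k - 1)) / cell_size e k"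
    have "((\<lambda>s. \<rho> s k) has_real_derivative ?D) (at t within {0<..})"
      using t by (intro has_field_derivative_subset[OF scheme_solution_deriv[OF sol _ k]]) auto
    then have "((\<lambda>s. \<rho> s k) has_real_derivative ?D) (at t)"
      using t by (simp add: at_within_open[of t "{0<..}"])
    then have "?D = 0"
    proof (rule DERIV_local_min[OF _ t], intro allI impI)
      fix s assume "\<bar>t - s\<bar> < t"
      then show "\<rho> t k \<le> \<rho> s k" using nonneg[of s k] k zk by auto
    qed
    then show ?thesis using cell_size_pos[OF mesh k] by simp
  qed
  have spread: "k < N \<Longrightarrow> \<rho> t (k + 1) = 0" "1 < k \<Longrightarrow> \<rho> t (k - 1) = 0"
    if k: "k \<in> {1..N}" and zk: "\<rho> t k = 0" for k
    using neighbours_vanish[OF mesh k nonneg zk stationary[OF k zk]] t by auto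
  show ?thesis
  proof (cases "j \<le> i")
    case True
    then have "i \<le> N \<longrightarrow> \<rho> t i = 0"
    proof (induction i rule: dec_induct)
      case (step n)
      then show ?case using spread(1)[of n] j by auto
    qed (use zero in simp)
    then show ?thesis using i by simp
  next
    case False
    then have "i \<le> j" by simp
    then have "1 \<le> i \<longrightarrow> \<rho> t i = 0"
    proof (induction i rule: inc_induct)
      case (step n)
      then show ?case using spread(2)[of "Suc n"] j by auto
    qed (use zero in simp)
    then show ?thesis using i by simp
  qed
qed

lemma positive_or_identically_zero:
  assumes mesh: "is_mesh a b N e" and sol: "scheme_solution N e V W \<rho>"
    and init: "\<And>j. j \<in> {1..N} \<Longrightarrow> 0 \<le> \<rho> 0 j" and t: "0 < t"
  obtains "\<And>j. j \<in> {1..N} \<Longrightarrow> 0 < \<rho> t j"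
  | "\<And>s j. 0 \<le> s \<Longrightarrow> j \<in> {1..N} \<Longrightarrow> \<rho> s j = 0"
proof (cases "\<exists>j\<in>{1..N}. \<rho> t j = 0")
  case True
  then have "\<rho> t i = 0" if "i \<in> {1..N}" for i
    using one_zero_imp_all_zero[OF mesh sol init t _ _ that] by auto
  then have no_mass: "(\<Sum>j=1..N. cell_size e j * \<rho> t j) = 0"
    by (intro sum.neutral) auto
  have "\<rho> s j = 0" if s: "0 \<le> s" and j: "j \<in> {1..N}" for s j
  proof -
    have "(\<Sum>j=1..N. cell_size e j * \<rho> s j) = 0"
      using mass_conservation[OF mesh sol s] mass_conservation[OF mesh sol, of t] t no_mass by simp
    moreover have "0 \<le> cell_size e i * \<rho> s i" if "i \<in> {1..N}" for i
      using cell_size_pos[OF mesh that] positivity_preserving[OF mesh sol init s that]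
      by (simp add: less_imp_le)
    ultimately have "cell_size e j * \<rho> s j = 0"
      using j by (subst (asm) sum_nonneg_eq_0_iff) auto
    then show ?thesis using cell_size_pos[OF mesh j] by simp
  qed
  then show ?thesis by (rule that(2))
next
  case False
  then have "0 < \<rho> t j" if "j \<in> {1..N}" for j
    using positivity_preserving[OF mesh sol init _ that, of t] t that by force
  then show ?thesis by (rule that(1))
qed

section \<open>Entropy dissipation\<close>

lemma ln_M_center: "ln (M_center N e V W v j) = - V (cell_center e j) - g_conv N e W v j"
  by (simp add: M_center_def Q1_def g_conv_def)

text \<open>
  The evenness of \<open>W\<close> makes the interaction energy a symmetric quadratic form, so that the two
  halves of its derivative coincide.
\<close>

lemma interaction_symmetric:
  assumes "\<And>x. W x = W (- x)"
  shows "(\<Sum>j=1..N. cell_size e j * (g_conv N e W d j * v j))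
    = (\<Sum>j=1..N. cell_size e j * (g_conv N e W v j * d j))"
proof -
  have W: "W (cell_center e i - cell_center e j) = W (cell_center e j - cell_center e i)" for i j
    using assms[of "cell_center e i - cell_center e j"] by simp
  have "(\<Sum>j=1..N. cell_size e j * (g_conv N e W d j * v j))
      = (\<Sum>j=1..N. \<Sum>i=1..N. cell_size e j * cell_size e i * W (cell_center e i - cell_center e j) * d i * v j)"
    by (simp add: g_conv_def sum_distrib_left sum_distrib_right mult_ac)
  also have "\<dots> = (\<Sum>i=1..N. \<Sum>j=1..N. cell_size e j * cell_size e i * W (cell_center e i - cell_center e j) * d i * v j)"
    by (rule sum.swap)
  also have "\<dots> = (\<Sum>i=1..N. cell_size e i * (g_conv N e W v i * d i))"
    unfolding g_conv_def sum_distrib_left sum_distrib_right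
    by (intro sum.cong refl) (subst W, simp add: mult_ac)
  finally show ?thesis .
qed

lemma free_energy_deriv:
  assumes W_even: "\<And>x. W x = W (- x)"
    and deriv: "\<And>j. j \<in> {1..N} \<Longrightarrow> ((\<lambda>s. \<rho> s j) has_real_derivative d j) (at t within S)"
    and pos: "\<And>j. j \<in> {1..N} \<Longrightarrow> 0 < \<rho> t j"
  shows "((\<lambda>s. free_energy N e V W (\<rho> s)) has_real_derivative
    (\<Sum>j=1..N. cell_size e j * ((ln (\<rho> t j / M_center N e V W (\<rho> t) j) + 1) * d j))) (at t within S)"
proof -
  let ?V = "\<lambda>j. V (cell_center e j)" and ?g = "g_conv N e W"
  have g: "((\<lambda>s. ?g (\<rho> s) j) has_real_derivative ?g d j) (at t within S)" for j
    unfolding g_conv_def by (intro DERIV_sum DERIV_cmult deriv) auto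
  have "((\<lambda>s. \<rho> s j * ln (\<rho> s j) + ?V j * \<rho> s j + 1/2 * ?g (\<rho> s) j * \<rho> s j) has_real_derivative
      (ln (\<rho> t j) + 1 + ?V j) * d j + (1/2 * (?g d j * \<rho> t j) + 1/2 * (?g (\<rho> t) j * d j)))
      (at t within S)" if j: "j \<in> {1..N}" for j
    by (rule derivative_eq_intros deriv[OF j] g refl pos[OF j])+
      (use pos[OF j] in \<open>simp add: algebra_simps\<close>)
  then have "((\<lambda>s. free_energy N e V W (\<rho> s)) has_real_derivative
      (\<Sum>j=1..N. cell_size e j * ((ln (\<rho> t j) + 1 + ?V j) * d j
        + (1/2 * (?g d j * \<rho> t j) + 1/2 * (?g (\<rho> t) j * d j))))) (at t within S)"
    unfolding free_energy_def by (intro DERIV_sum DERIV_cmult) auto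
  also have "(\<Sum>j=1..N. cell_size e j * ((ln (\<rho> t j) + 1 + ?V j) * d j
        + (1/2 * (?g d j * \<rho> t j) + 1/2 * (?g (\<rho> t) j * d j))))
      = (\<Sum>j=1..N. cell_size e j * ((ln (\<rho> t j) + 1 + ?V j) * d j))
        + 1/2 * (\<Sum>j=1..N. cell_size e j * (?g d j * \<rho> t j))
        + 1/2 * (\<Sum>j=1..N. cell_size e j * (?g (\<rho> t) j * d j))"
    by (simp add: sum.distrib sum_distrib_left algebra_simps)
  also have "\<dots> = (\<Sum>j=1..N. cell_size e j * ((ln (\<rho> t j) + 1 + ?V j) * d j))
        + (\<Sum>j=1..N. cell_size e j * (?g (\<rho> t) j * d j))"
    using interaction_symmetric[where W = W and d = d and v = "\<rho> t" and N = N and e = e, OF W_even]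
    by linarith
  also have "\<dots> = (\<Sum>j=1..N. cell_size e j * ((ln (\<rho> t j) + 1 + ?V j + ?g (\<rho> t) j) * d j))"
    by (simp add: sum.distrib[symmetric] algebra_simps)
  also have "\<dots> = (\<Sum>j=1..N. cell_size e j * ((ln (\<rho> t j / M_center N e V W (\<rho> t) j) + 1) * d j))"
  proof (intro sum.cong refl)
    fix j assume "j \<in> {1..N}"
    from pos[OF this] M_center_pos[of N e V W "\<rho> t" j]
    show "cell_size e j * ((ln (\<rho> t j) + 1 + ?V j + ?g (\<rho> t) j) * d j)
        = cell_size e j * ((ln (\<rho> t j / M_center N e V W (\<rho> t) j) + 1) * d j)"
      by (simp add: ln_div ln_M_center)
  qed
  finally show ?thesis .
qed

lemma dissipation_nonneg:
  assumes mesh: "is_mesh a b N e" and pos: "\<And>j. j \<in> {1..N} \<Longrightarrow> 0 < v j"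
  shows "0 \<le> dissipation N e V W v"
  unfolding dissipation_def
proof (rule sum_nonneg)
  fix j assume "j \<in> {1..N-1}"
  then have j: "j \<in> {1..N}" "j + 1 \<in> {1..N}" by auto
  define p where "p i = v i / M_center N e V W v i" for i
  have p: "0 < p j" "0 < p (j + 1)"
    using pos[OF j(1)] pos[OF j(2)] M_center_pos by (simp_all add: p_def)
  have "0 \<le> (p (j + 1) - p j) * (ln (p (j + 1)) - ln (p j))"
  proof (cases "p j \<le> p (j + 1)")
    case True
    then show ?thesis using p by (intro mult_nonneg_nonneg) auto
  next
    case False
    then show ?thesis using p by (intro mult_nonpos_nonpos) auto
  qed
  then have "0 \<le> conductance N e V W v j * ((p (j + 1) - p j) * (ln (p (j + 1)) - ln (p j)))"
    by (rule mult_nonneg_nonneg[OF conductance_nonneg[OF mesh]])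
  then show "0 \<le> flux N e V W v j * (ln (v (j + 1) / M_center N e V W v (j + 1))
      - ln (v j / M_center N e V W v j))"
    by (simp add: flux_eq_conductance p_def mult.assoc)
qed

text \<open>
  The factor \<open>log p\<^sub>j + 1\<close> of \<open>\<rho>\<^sub>j'\<close> enters the sum by parts only through its differences, so the
  constant \<open>1\<close> drops out and the dissipation remains, with equality.
\<close>

lemma entropy_dissipation_if_positive:
  assumes W_even: "\<And>x. W x = W (- x)"
    and mesh: "is_mesh a b N e" and sol: "scheme_solution N e V W \<rho>"
    and t: "0 \<le> t" and pos: "\<And>j. j \<in> {1..N} \<Longrightarrow> 0 < \<rho> t j"
  shows "entropy_dissipation_at N e V W \<rho> t"
proof -
  define \<phi> where "\<phi> j = ln (\<rho> t j / M_center N e V W (\<rho> t) j) + 1" for j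
  have "((\<lambda>s. free_energy N e V W (\<rho> s)) has_real_derivative
      (\<Sum>j=1..N. cell_size e j * (\<phi> j *
        ((flux N e V W (\<rho> t) j - flux N e V W (\<rho> t) (j - 1)) / cell_size e j)))) (at t within {0..})"
    unfolding \<phi>_def
    by (rule free_energy_deriv[where W = W and \<rho> = \<rho> and t = t, OF W_even scheme_solution_deriv[OF sol t] pos])
  also have "(\<Sum>j=1..N. cell_size e j * (\<phi> j *
        ((flux N e V W (\<rho> t) j - flux N e V W (\<rho> t) (j - 1)) / cell_size e j)))
      = (\<Sum>j=1..N. \<phi> j * (flux N e V W (\<rho> t) j - flux N e V W (\<rho> t) (j - 1)))"
    using cell_size_pos[OF mesh] by (intro sum.cong refl) force
  also have "\<dots> = - dissipation N e V W (\<rho> t)"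
    unfolding summation_by_parts_flux[OF mesh] by (simp add: dissipation_def \<phi>_def)
  finally show ?thesis
    using dissipation_nonneg[OF mesh pos] by (auto simp: entropy_dissipation_at_def)
qed

lemma entropy_dissipation_if_zero:
  assumes zero: "\<And>s j. 0 \<le> s \<Longrightarrow> j \<in> {1..N} \<Longrightarrow> \<rho> s j = 0" and t: "0 \<le> t"
  shows "entropy_dissipation_at N e V W \<rho> t"
proof -
  have energy: "free_energy N e V W (\<rho> s) = 0" if "s \<in> {0..}" for s
    using zero that by (simp add: free_energy_def)
  have "((\<lambda>s. free_energy N e V W (\<rho> s)) has_real_derivative 0) (at t within {0..})"
    using t by (intro has_field_derivative_transform_within[OF DERIV_const zero_less_one])
      (auto simp: energy)
  moreover have "dissipation N e V W (\<rho> t) = 0"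
    using zero t by (auto simp: dissipation_def flux_def intro!: sum.neutral)
  ultimately show ?thesis by (auto simp: entropy_dissipation_at_def)
qed

theorem theorem2p1:
  fixes V W :: "real \<Rightarrow> real" and a b :: real and N :: nat
    and e :: "nat \<Rightarrow> real" and \<rho> :: "real \<Rightarrow> nat \<Rightarrow> real"
  assumes W_even: "\<And>x. W x = W (- x)"
    and mesh: "is_mesh a b N e"
    and solution: "scheme_solution N e V W \<rho>"
  shows
    "(\<forall>t>0. (\<Sum>j=1..N. cell_size e j * \<rho> t j) = (\<Sum>j=1..N. cell_size e j * \<rho> 0 j)) \<and>
     ((\<forall>j\<in>{1..N}. 0 \<le> \<rho> 0 j) \<longrightarrow> (\<forall>t>0. \<forall>j\<in>{1..N}. 0 \<le> \<rho> t j)) \<and>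
     ((\<forall>j\<in>{1..N}. 0 \<le> \<rho> 0 j) \<longrightarrow> (\<forall>t>0. entropy_dissipation_at N e V W \<rho> t)) \<and>
     (\<forall>t\<ge>0. (\<forall>j\<in>{1..N}. 0 < \<rho> t j) \<longrightarrow> entropy_dissipation_at N e V W \<rho> t)"
proof (intro conjI allI impI ballI)
  fix t :: real
  assume "t > 0"
  then show "(\<Sum>j=1..N. cell_size e j * \<rho> t j) = (\<Sum>j=1..N. cell_size e j * \<rho> 0 j)"
    by (intro mass_conservation[OF mesh solution]) simp
next
  fix t :: real and j
  assume "\<forall>j\<in>{1..N}. 0 \<le> \<rho> 0 j" "t > 0" "j \<in> {1..N}"
  then show "0 \<le> \<rho> t j"
    using positivity_preserving[OF mesh solution, of t j] by simp
next
  fix t :: real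
  assume init: "\<forall>j\<in>{1..N}. 0 \<le> \<rho> 0 j" and t: "t > 0"
  show "entropy_dissipation_at N e V W \<rho> t"
  proof (rule positive_or_identically_zero[OF mesh solution _ t])
    show "0 \<le> \<rho> 0 j" if "j \<in> {1..N}" for j
      using init that by simp
  next
    assume "\<And>j. j \<in> {1..N} \<Longrightarrow> 0 < \<rho> t j"
    then show ?thesis
      by (intro entropy_dissipation_if_positive[of W, OF W_even mesh solution]) (use t in auto)
  next
    assume "\<And>s j. 0 \<le> s \<Longrightarrow> j \<in> {1..N} \<Longrightarrow> \<rho> s j = 0"
    then show ?thesis
      by (rule entropy_dissipation_if_zero) (use t in auto)
  qed
next
  fix t :: real
  assume "t \<ge> 0" "\<forall>j\<in>{1..N}. 0 < \<rho> t j"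
  then show "entropy_dissipation_at N e V W \<rho> t"
    by (intro entropy_dissipation_if_positive[of W, OF W_even mesh solution]) auto
qed

end
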